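(* Let $E$ be any analytic equivalence relation on $\mathcal{P}(\omega)$. Then there exists an infinite sequence $(A_n)_{n\in\omega}$ of pairwise disjoint non-empty (finite or infinite) subsets of $\omega$ such that one of the following holds: (a) for all $S,T\subseteq\omega$ with $0\in S$, $0\in T$ and $S\neq T$, the sets $\bigcup_{i\in S}A_i$ and $\bigcup_{i\in T}A_i$ are $E$-equivalent; or (b) for all $S,T\subseteq\omega$ with $0\in S$, $0\in T$ and $S\neq T$, the sets $\bigcup_{i\in S}A_i$ and $\bigcup_{i\in T}A_i$ are not $E$-equivalent.
   Context: $\omega=\{0,1,2,\dots\}$. The power set $\mathcal{P}(\omega)$ is identified with the Cantor space $2^\omega$ (product topology) via characteristic functions; "analytic equivalence relation on $\mathcal{P}(\omega)$" means an equivalence relation that is an analytic ($\mathbf{\Sigma}^1_1$) subset of $2^\omega\times 2^\omega$. *)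

theory Defs
  imports "HOL-Analysis.Function_Topology" "HOL-Library.Disjoint_Sets"
begin

text \<open>
  Boldface \<open>\<Sigma>\<^sup>1\<^sub>1\<close>: the projections along the Baire space \<open>nat \<Rightarrow> nat\<close> (product of discrete
  spaces) of closed sets. This is meant for Polish \<open>'a\<close>, where it agrees with the other usual
  definition (continuous images of Polish spaces).
\<close>

definition analytic_set :: "'a::topological_space set \<Rightarrow> bool" where
  "analytic_set A \<longleftrightarrow>
     (\<exists>C :: ('a \<times> (nat \<Rightarrow> nat)) set. closed C \<and> A = fst ` C)"

text \<open>
  The type \<open>nat set\<close> carries no topology in the library; the Cantor space is \<open>nat \<Rightarrow> bool\<close> with
  the product topology, the order topology on \<open>bool\<close> being discrete.
\<close>

definition char_fun :: "nat set \<Rightarrow> nat \<Rightarrow> bool" where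
  "char_fun S = (\<lambda>n. n \<in> S)"

definition analytic_relation :: "(nat set \<times> nat set) set \<Rightarrow> bool" where
  "analytic_relation E \<longleftrightarrow> analytic_set (map_prod char_fun char_fun ` E)"

end

theory Submission
  imports Defs
begin

text \<open>
  Code a pair \<open>(X, Y)\<close> of subsets of \<open>\<omega>\<close> as a sequence over the alphabet \<open>bool \<times> bool\<close>. The
  argument compares the size, in the sense of Baire category, of \<open>E\<close> inside two spaces: the space
  of all pairs, and the space of nested pairs \<open>X \<subseteq> Y\<close>, that is, of sequences that omit the letter
  \<open>(True, False)\<close>. Both spaces are needed: if \<open>S \<subset> T\<close> then the unions of the \<open>A i\<close> form a nested
  pair, and the nested pairs are negligible among all pairs, so the category of \<open>E\<close> in the large
  space says nothing about them. To work over one alphabet, nested pairs are coded by arbitrary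
  sequences through the retraction \<open>(p, q) \<mapsto> (p \<and> q, q)\<close>.

  Two facts carry the proof. Analytic sets have the Baire property, so a nonmeager one is comeager
  in some cylinder (\<open>nonmeager_projection_locally_comeager\<close>). And a meager set of sequences over a
  finite alphabet is avoided by all sequences that agree, on infinitely many blocks of a suitable
  sequence of consecutive intervals, with one fixed sequence \<open>z\<close> (\<open>meager_avoided_by_blocks\<close>).

  If \<open>E\<close> is nonmeager in one of the two spaces, then in some cylinder every pair that agrees with
  \<open>z\<close> on infinitely many blocks is in \<open>E\<close>. Let \<open>X\<close> and \<open>A 0\<close> follow the two components of \<open>z\<close> on the
  even blocks and on the prefix that defines the cylinder, let \<open>X\<close> be empty on the odd blocks, and choose one further point for each \<open>A n\<close> in
  an odd block. Then \<open>X\<close> is \<open>E\<close>-equivalent to \<open>\<Union>i\<in>S. A i\<close> for every \<open>S\<close> that contains \<open>0\<close>, so all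
  these unions are equivalent (\<open>homogeneous_if_nonmeager\<close>).

  If \<open>E\<close> is meager in both spaces, one \<open>z\<close> avoids both meager sets. Assign to each block a pair
  \<open>(i, j)\<close>, each pair infinitely often. On such a block, distribute the points over \<open>A 0\<close>, \<open>A i\<close>,
  \<open>A j\<close> and the complement of all the \<open>A n\<close> so that \<open>z\<close> is copied by the pair of unions over
  \<open>S\<close> and \<open>T\<close> whenever \<open>i \<in> S - T\<close> and \<open>j \<in> T - S\<close>. For \<open>S \<subset> T\<close> no such \<open>i\<close> exists, and blocks
  with \<open>i = 0\<close> do the same for nested pairs (\<open>independent_if_meager\<close>).
\<close>

section \<open>Category in a sequence space\<close>

definition initial :: "(nat \<Rightarrow> 'k) \<Rightarrow> nat \<Rightarrow> 'k list" where
  "initial f n = map f [0..<n]"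

text \<open>
  A set of finite strings stands for the open set of all sequences with an initial segment in it;
  if the strings are dense in the following sense, then so is that open set.
\<close>

definition dense_strings :: "'k list set \<Rightarrow> bool" where
  "dense_strings D \<longleftrightarrow> (\<forall>u. \<exists>v. u @ v \<in> D)"

definition meets :: "(nat \<Rightarrow> 'k) \<Rightarrow> 'k list set \<Rightarrow> bool" where
  "meets f D \<longleftrightarrow> (\<exists>n. initial f n \<in> D)"

definition meager :: "(nat \<Rightarrow> 'k) set \<Rightarrow> bool" where
  "meager X \<longleftrightarrow>
     (\<exists>D :: nat \<Rightarrow> 'k list set. (\<forall>i. dense_strings (D i)) \<and> (\<forall>f\<in>X. \<exists>i. \<not> meets f (D i)))"

definition cylinder :: "'k list \<Rightarrow> (nat \<Rightarrow> 'k) set" where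
  "cylinder u = {f. initial f (length u) = u}"

lemma length_initial [simp]: "length (initial f n) = n"
  by (simp add: initial_def)

lemma initial_0 [simp]: "initial f 0 = []"
  by (simp add: initial_def)

lemma initial_Suc: "initial f (Suc n) = initial f n @ [f n]"
  by (simp add: initial_def)

lemma initial_eq_iff: "initial f n = initial g n \<longleftrightarrow> (\<forall>t<n. f t = g t)"
  by (auto simp: initial_def)

lemma initial_append: "initial f (m + k) = initial f m @ map f [m..<m + k]"
  by (simp add: initial_def upt_add_eq_append[of 0 m k])

lemma initial_extends: "m \<le> n \<Longrightarrow> \<exists>v. initial f n = initial f m @ v"
  using initial_append[of f m "n - m"] by auto

lemma take_initial: "m \<le> n \<Longrightarrow> take m (initial f n) = initial f m"
  by (simp add: initial_def take_map)

lemma initial_mem_cylinder [simp]: "f \<in> cylinder (initial f n)"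
  by (simp add: cylinder_def)

lemma cylinder_Nil [simp]: "cylinder [] = UNIV"
  by (simp add: cylinder_def)

lemma meager_subset: "meager Y \<Longrightarrow> X \<subseteq> Y \<Longrightarrow> meager X"
  unfolding meager_def by blast

lemma dense_strings_UNIV [simp]: "dense_strings UNIV"
  by (simp add: dense_strings_def)

lemma meager_empty [simp]: "meager {}"
  unfolding meager_def by (auto intro!: exI[of _ "\<lambda>_. UNIV"])

lemma meager_avoiding_dense: "dense_strings D \<Longrightarrow> meager {f. \<not> meets f D}"
  unfolding meager_def by (auto intro!: exI[of _ "\<lambda>_. D"])

lemma meager_UN:
  fixes X :: "'i::countable \<Rightarrow> (nat \<Rightarrow> 'k) set"
  assumes "\<And>i. meager (X i)"
  shows "meager (\<Union>i. X i)"
proof -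
  obtain D :: "'i \<Rightarrow> nat \<Rightarrow> 'k list set"
    where D: "\<And>i n. dense_strings (D i n)"
      and X: "\<And>i f. f \<in> X i \<Longrightarrow> \<exists>n. \<not> meets f (D i n)"
    using assms unfolding meager_def by metis
  define D' where "D' m = D (from_nat (fst (prod_decode m))) (snd (prod_decode m))" for m
  have D'_code: "D' (prod_encode (to_nat i, n)) = D i n" for i n
    by (simp add: D'_def)
  have "\<exists>m. \<not> meets f (D' m)" if "f \<in> (\<Union>i. X i)" for f
  proof -
    obtain i n where "\<not> meets f (D i n)" using X \<open>f \<in> (\<Union>i. X i)\<close> by blast
    then have "\<not> meets f (D' (prod_encode (to_nat i, n)))"
      using D'_code by simp
    then show ?thesis ..
  qed
  moreover have "dense_strings (D' m)" for m
    by (simp add: D D'_def)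
  ultimately show ?thesis
    unfolding meager_def by blast
qed

lemma meager_Un:
  assumes "meager X" and "meager Y"
  shows "meager (X \<union> Y)"
proof -
  have "X \<union> Y = (\<Union>b. if b then X else Y)"
    by (auto split: if_splits)
  then show ?thesis
    using meager_UN[of "\<lambda>b. if b then X else Y"] assms by simp
qed

text \<open>
  The Banach category theorem for sequence spaces, relative to a cylinder. There are only countably
  many cylinders, so the union of those in which the set is meager contributes a meager set, and
  that union is open and dense, so its complement contributes a meager set as well.
\<close>

lemma meager_if_densely_meager:
  fixes X :: "(nat \<Rightarrow> 'k::countable) set"
  assumes "\<And>v. \<exists>w. meager (X \<inter> cylinder (u @ v @ w))"
  shows "meager (X \<inter> cylinder u)"
proof -
  define Y where "Y = X \<inter> cylinder u"
  define G where "G = {v. meager (Y \<inter> cylinder v)}"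
  \<comment> \<open>Strings incompatible with \<open>u\<close> are in \<open>G\<close> for the trivial reason that \<open>Y\<close> misses their cylinders.\<close>
  have "\<exists>w. v @ w \<in> G" for v
  proof (cases "\<exists>r. u @ r = v \<or> v @ r = u")
    case True
    then obtain r where "u @ r = v \<or> v @ r = u" by blast
    then show ?thesis
    proof
      assume r: "u @ r = v"
      obtain w where "meager (X \<inter> cylinder (u @ r @ w))" using assms by blast
      then have "v @ w \<in> G"
        using r unfolding G_def Y_def by (auto intro: meager_subset)
      then show ?thesis ..
    next
      assume r: "v @ r = u"
      obtain w where "meager (X \<inter> cylinder (u @ [] @ w))" using assms by blast
      then have "v @ r @ w \<in> G"
        using r unfolding G_def Y_def by (auto intro: meager_subset)
      then show ?thesis ..
    qed
  next
    case False
    have "cylinder u \<inter> cylinder v = {}"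
    proof (rule ccontr)
      assume "cylinder u \<inter> cylinder v \<noteq> {}"
      then obtain f where "initial f (length u) = u" "initial f (length v) = v"
        by (auto simp: cylinder_def)
      then have "\<exists>r. v = u @ r" if "length u \<le> length v"
        using initial_extends[OF that, of f] by simp
      moreover have "\<exists>r. u = v @ r" if "length v \<le> length u"
        using initial_extends[OF that, of f] \<open>initial f (length u) = u\<close> \<open>initial f (length v) = v\<close> by simp
      ultimately show False
        using False linorder_le_cases[of "length u" "length v"] by blast
    qed
    then have "Y \<inter> cylinder (v @ []) = {}"
      unfolding Y_def by auto
    then have "v @ [] \<in> G" unfolding G_def by simp
    then show ?thesis ..
  qed
  then have "meager {f. \<not> meets f G}"
    by (simp add: dense_strings_def meager_avoiding_dense)
  moreover have "meager (\<Union>v. if v \<in> G then Y \<inter> cylinder v else {})"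
    by (rule meager_UN) (simp add: G_def)
  moreover have "Y \<subseteq> {f. \<not> meets f G} \<union> (\<Union>v. if v \<in> G then Y \<inter> cylinder v else {})"
    by (auto simp: meets_def intro: initial_mem_cylinder)
  ultimately show ?thesis
    unfolding Y_def[symmetric] by (rule meager_subset[OF meager_Un])
qed

section \<open>Projections of closed sets have the Baire property\<close>

text \<open>
  The first hypothesis says that the graph of \<open>R\<close> is closed: a point belongs to it as soon as all
  its basic neighbourhoods meet it.

  Let \<open>A s\<close> be the projection of the part of \<open>R\<close> with witness in the cylinder of \<open>s\<close>, and let \<open>V s\<close>
  consist of the strings in whose cylinder \<open>A s\<close> is everywhere nonmeager. As \<open>A s\<close> is the
  countable union of the \<open>A (s @ [k])\<close>, each string in \<open>V s\<close> extends to one in \<open>V (s @ [k])\<close> for some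
  \<open>k\<close>. Starting from \<open>u \<in> V []\<close>, a generic sequence through \<open>u\<close> therefore yields, step by step, some
  \<open>w\<close> such that \<open>A s\<close> accumulates at the sequence for each initial segment \<open>s\<close> of \<open>w\<close>; since \<open>R\<close> is
  closed, \<open>w\<close> is a witness for the sequence itself.
\<close>

lemma nonmeager_projection_locally_comeager:
  fixes R :: "(nat \<Rightarrow> 'k::countable) \<Rightarrow> (nat \<Rightarrow> nat) \<Rightarrow> bool"
  assumes closed: "\<And>f w. (\<And>n. \<exists>g y. R g y \<and> initial g n = initial f n \<and> initial y n = initial w n) \<Longrightarrow> R f w"
    and nonmeager: "\<not> meager {f. \<exists>w. R f w}"
  shows "\<exists>u. meager (cylinder u - {f. \<exists>w. R f w})"
proof -
  define A where "A s = {f. \<exists>w. R f w \<and> w \<in> cylinder s}" for s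
  define V where "V s = {u. \<forall>v. \<not> meager (A s \<inter> cylinder (u @ v))}" for s
  have V_append: "u @ v \<in> V s" if "u \<in> V s" for u v s
    using that by (simp add: V_def)
  have A_split: "A s = (\<Union>k. A (s @ [k]))" for s
  proof -
    have "w \<in> cylinder s \<longleftrightarrow> (\<exists>k. w \<in> cylinder (s @ [k]))" for w
      by (simp add: cylinder_def initial_Suc)
    then show ?thesis by (auto simp: A_def)
  qed
  have V_step: "\<exists>k v. u @ v \<in> V (s @ [k])" if "u \<in> V s" for u s
  proof (rule ccontr)
    assume none: "\<nexists>k v. u @ v \<in> V (s @ [k])"
    have "meager (A (s @ [k]) \<inter> cylinder u)" for k
      using none by (intro meager_if_densely_meager) (auto simp: V_def)
    then have "meager (\<Union>k. A (s @ [k]) \<inter> cylinder u)"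
      by (rule meager_UN)
    then have "meager (A s \<inter> cylinder (u @ []))"
      by (simp add: A_split[of s])
    then show False
      using that unfolding V_def by blast
  qed
  \<comment> \<open>The second alternative makes \<open>D s\<close> dense; no sequence with an initial segment in \<open>V s\<close> uses it.\<close>
  define D where "D s = {v. (\<exists>k. v \<in> V (s @ [k])) \<or> (\<forall>r. v @ r \<notin> V s)}" for s
  have "dense_strings (D s)" for s
    unfolding dense_strings_def
  proof
    fix u
    show "\<exists>v. u @ v \<in> D s"
    proof (cases "\<exists>r. u @ r \<in> V s")
      case True
      then obtain r where "u @ r \<in> V s" by blast
      then obtain k v where "(u @ r) @ v \<in> V (s @ [k])" using V_step by blast
      then have "u @ (r @ v) \<in> D s" unfolding D_def by auto
      then show ?thesis ..
    next
      case False
      then have "u @ [] \<in> D s" by (simp add: D_def)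
      then show ?thesis ..
    qed
  qed
  then have small: "meager (\<Union>s. {f. \<not> meets f (D s)})"
    by (intro meager_UN meager_avoiding_dense)
  have "\<exists>u. u \<in> V []"
  proof (rule ccontr)
    assume "\<nexists>u. u \<in> V []"
    then have "meager (A [] \<inter> cylinder [])"
      by (intro meager_if_densely_meager) (auto simp: V_def)
    then show False
      using nonmeager by (simp add: A_def)
  qed
  then obtain u where u: "u \<in> V []" by blast
  have generic: "\<exists>w. R f w" if f: "f \<in> cylinder u" and meets: "\<And>s. meets f (D s)" for f
  proof -
    define P where "P s \<longleftrightarrow> (\<exists>m. initial f m \<in> V s)" for s
    have "\<exists>k. P (s @ [k])" if "P s" for s
    proof -
      obtain m where m: "initial f m \<in> V s" using \<open>P s\<close> by (auto simp: P_def)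
      obtain n where n: "initial f n \<in> D s" using meets by (auto simp: meets_def)
      obtain r where r: "initial f (max m n) = initial f n @ r"
        using initial_extends[of n "max m n"] by auto
      obtain r' where "initial f (max m n) = initial f m @ r'"
        using initial_extends[of m "max m n"] by auto
      then have "initial f n @ r \<in> V s"
        using r V_append[OF m] by simp
      then show ?thesis
        using n unfolding D_def P_def by blast
    qed
    then obtain k where k: "\<And>s. P s \<Longrightarrow> P (s @ [k s])" by metis
    define s where "s = rec_nat [] (\<lambda>_ l. l @ [k l])"
    define w where "w n = k (s n)" for n
    have s_simps: "s 0 = []" "s (Suc n) = s n @ [w n]" for n
      by (simp_all add: s_def w_def)
    have s_eq: "initial w n = s n" for n
      by (induction n) (simp_all add: s_simps initial_Suc)
    have "P []"
      using u f unfolding P_def cylinder_def by (metis mem_Collect_eq)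
    then have P: "P (initial w n)" for n
      unfolding s_eq by (induction n) (auto simp: s_simps k w_def)
    have "R f w"
    proof (rule closed)
      fix n
      obtain m where m: "initial f m \<in> V (initial w n)" using P by (auto simp: P_def)
      obtain r where "initial f (max m n) = initial f m @ r"
        using initial_extends[of m "max m n"] by auto
      then have "A (initial w n) \<inter> cylinder (initial f (max m n)) \<noteq> {}"
        using m unfolding V_def by (metis (mono_tags, lifting) mem_Collect_eq meager_empty)
      then obtain g y where "R g y" "initial y n = initial w n"
        "initial g (max m n) = initial f (max m n)"
        by (auto simp: A_def cylinder_def)
      then show "\<exists>g y. R g y \<and> initial g n = initial f n \<and> initial y n = initial w n"
        by (intro exI[of _ g] exI[of _ y]) (auto simp: initial_eq_iff)
    qed
    then show ?thesis by blast
  qed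
  have "cylinder u - {f. \<exists>w. R f w} \<subseteq> (\<Union>s. {f. \<not> meets f (D s)})"
    using generic by auto
  then show ?thesis
    using small meager_subset by blast
qed

section \<open>Blocks that force a sequence out of a meager set\<close>

text \<open>
  Finitely many strings can be treated one after the other, because membership in \<open>D\<close> persists
  under further extension. Over a finite alphabet this applies to all strings of a given length.
\<close>

lemma simultaneous_extension:
  assumes "dense_strings D" and ext: "\<And>u v. u \<in> D \<Longrightarrow> u @ v \<in> D" and "finite U"
  shows "\<exists>v. v \<noteq> [] \<and> (\<forall>u\<in>U. u @ v \<in> D)"
  using \<open>finite U\<close>
proof induction
  case empty
  then show ?case by blast
next
  case (insert u U)
  then obtain v where v: "v \<noteq> []" "\<forall>u\<in>U. u @ v \<in> D" by blast
  obtain r where "(u @ v) @ r \<in> D"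
    using assms(1) unfolding dense_strings_def by blast
  then have "v @ r \<noteq> [] \<and> (\<forall>x\<in>insert u U. x @ v @ r \<in> D)"
    using v ext[of "_ @ v" r] by auto
  then show ?case ..
qed

text \<open>
  The \<open>n\<close>-th block of \<open>z\<close> is chosen such that appending it to any string of length \<open>a n\<close> enters the
  first \<open>n\<close> dense open sets. Hence a sequence that agrees with \<open>z\<close> on infinitely many blocks enters all
  of them, whatever it does elsewhere. The prefix \<open>u\<close> allows the use relative to a cylinder.
\<close>

lemma meager_avoided_by_blocks:
  fixes X :: "(nat \<Rightarrow> 'k::finite) set"
  assumes "meager X"
  shows "\<exists>a z. strict_mono a \<and> a 0 = length u \<and> (\<forall>t<length u. z t = u ! t) \<and>
    (\<forall>f. (\<exists>\<^sub>\<infinity>n. \<forall>t\<in>{a n..<a (Suc n)}. f t = z t) \<longrightarrow> f \<notin> X)"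
proof -
  obtain D :: "nat \<Rightarrow> 'k list set"
    where D: "\<And>i. dense_strings (D i)" and X: "\<And>f. f \<in> X \<Longrightarrow> \<exists>i. \<not> meets f (D i)"
    using assms unfolding meager_def by metis
  \<comment> \<open>The first \<open>n\<close> open sets intersected, in a form that is closed under extending strings.\<close>
  define D' where "D' n = {v. \<forall>i<n. \<exists>k\<le>length v. take k v \<in> D i}" for n :: nat
  have D'_append: "v @ r \<in> D' n" if v: "v \<in> D' n" for v r n
    unfolding D'_def
  proof (intro CollectI allI impI)
    fix i assume "i < n"
    then obtain k where "k \<le> length v" "take k v \<in> D i"
      using v unfolding D'_def by blast
    then show "\<exists>k\<le>length (v @ r). take k (v @ r) \<in> D i"
      by (intro exI[of _ k]) simp
  qed
  have D'_dense: "dense_strings (D' n)" for n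
  proof (induction n)
    case 0
    then show ?case by (simp add: D'_def)
  next
    case (Suc n)
    show ?case
      unfolding dense_strings_def
    proof
      fix u
      obtain v where v: "u @ v \<in> D' n" using Suc unfolding dense_strings_def by blast
      obtain r where r: "(u @ v) @ r \<in> D n" using D unfolding dense_strings_def by blast
      have "\<exists>k\<le>length (u @ v @ r). take k (u @ v @ r) \<in> D i" if "i < Suc n" for i
      proof (cases "i = n")
        case True
        then show ?thesis using r by (intro exI[of _ "length (u @ v @ r)"]) simp
      next
        case False
        then show ?thesis using that D'_append[OF v, of r] unfolding D'_def by simp
      qed
      then have "u @ (v @ r) \<in> D' (Suc n)"
        unfolding D'_def by blast
      then show "\<exists>v. u @ v \<in> D' (Suc n)" ..
    qed
  qed
  have "\<exists>v. v \<noteq> [] \<and> (\<forall>u\<in>{u. length u = m}. u @ v \<in> D' n)" for m n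
    using D'_dense D'_append finite_lists_length_eq[of "UNIV :: 'k set" m]
    by (intro simultaneous_extension) auto
  then have "\<forall>m n. \<exists>v. v \<noteq> [] \<and> (\<forall>u\<in>{u. length u = m}. u @ v \<in> D' n)"
    by blast
  then obtain h where "\<forall>m n. h m n \<noteq> [] \<and> (\<forall>u\<in>{u. length u = m}. u @ h m n \<in> D' n)"
    unfolding choice_iff by blast
  then have h_ne: "\<And>m n. h m n \<noteq> []"
    and h: "\<And>m n u. length u = m \<Longrightarrow> u @ h m n \<in> D' n"
    by auto
  define Z where "Z = rec_nat u (\<lambda>n l. l @ h (length l) n)"
  have Z_0: "Z 0 = u" and Z_Suc: "Z (Suc n) = Z n @ h (length (Z n)) n" for n
    by (simp_all add: Z_def)
  define a where "a n = length (Z n)" for n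
  define z where "z t = Z (Suc t) ! t" for t
  have a_mono: "strict_mono a"
    by (simp add: strict_mono_Suc_iff a_def Z_Suc h_ne)
  have Z_ext: "\<exists>r. Z (n + d) = Z n @ r" for n d
    by (induction d) (auto simp: Z_Suc)
  have Z_nth: "Z n ! t = z t" if "t < a n" for n t
  proof -
    have "t < a (Suc t)"
      using strict_mono_imp_increasing[OF a_mono, of "Suc t"] by simp
    moreover obtain d where "n = Suc t + d \<or> Suc t = n + d"
      by (metis le_add_diff_inverse nat_le_linear)
    ultimately show ?thesis
      using that Z_ext[of n d] Z_ext[of "Suc t" d]
      unfolding z_def a_def by (auto simp: nth_append)
  qed
  have "f \<notin> X" if match: "\<exists>\<^sub>\<infinity>n. \<forall>t\<in>{a n..<a (Suc n)}. f t = z t" for f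
  proof
    assume "f \<in> X"
    then obtain i where i: "\<not> meets f (D i)" using X by blast
    obtain n where n: "n > i" and fz: "\<forall>t\<in>{a n..<a (Suc n)}. f t = z t"
      using match unfolding INFM_nat by blast
    define b where "b = h (a n) n"
    have a_Suc: "a (Suc n) = a n + length b"
      by (simp add: a_def b_def Z_Suc)
    have "map f [a n..<a n + length b] = b"
    proof (rule nth_equalityI)
      fix k assume "k < length (map f [a n..<a n + length b])"
      then have k: "k < length b" by simp
      have "Z (Suc n) ! (a n + k) = b ! k"
        by (simp add: Z_Suc a_def b_def nth_append)
      then show "map f [a n..<a n + length b] ! k = b ! k"
        using k fz Z_nth[of "a n + k" "Suc n"] by (simp add: a_Suc)
    qed simp
    then have "initial f (a (Suc n)) \<in> D' n"
      using h[of "initial f (a n)" "a n" n] by (simp add: a_Suc initial_append b_def)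
    then obtain k where "k \<le> a (Suc n)" "take k (initial f (a (Suc n))) \<in> D i"
      using n unfolding D'_def by auto
    then show False
      using i by (auto simp: meets_def take_initial)
  qed
  moreover have "a 0 = length u" "\<forall>t<length u. z t = u ! t"
    using Z_nth[of _ 0] by (auto simp: a_def Z_0)
  ultimately show ?thesis
    using a_mono by blast
qed

lemma block_unique:
  fixes a :: "nat \<Rightarrow> nat"
  assumes "strict_mono a" and "t \<in> {a n..<a (Suc n)}" and "t \<in> {a m..<a (Suc m)}"
  shows "n = m"
proof (rule ccontr)
  assume "n \<noteq> m"
  then consider "Suc n \<le> m" | "Suc m \<le> n" by linarith
  then show False
    using assms strict_mono_less_eq[OF assms(1), of "Suc n" m]
      strict_mono_less_eq[OF assms(1), of "Suc m" n] by cases auto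
qed

section \<open>Analytic relations as sets of sequences\<close>

definition pair_of :: "(nat \<Rightarrow> bool \<times> bool) \<Rightarrow> nat set \<times> nat set" where
  "pair_of f = ({t. fst (f t)}, {t. snd (f t)})"

text \<open>
  A retraction of the alphabet onto the letters that occur in codes of nested pairs.
\<close>

definition nest :: "bool \<times> bool \<Rightarrow> bool \<times> bool" where
  "nest = (\<lambda>(p, q). (p \<and> q, q))"

lemma pair_of_char: "pair_of (\<lambda>t. (t \<in> X, t \<in> Y)) = (X, Y)"
  by (simp add: pair_of_def)

lemma tendsto_if_eventually_coordinatewise_eq:
  fixes g :: "'a \<Rightarrow> 'i \<Rightarrow> 'b::topological_space"
  assumes "\<And>t. \<forall>\<^sub>F n in F. g n t = f t"
  shows "(g \<longlongrightarrow> f) F"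
proof -
  have "limitin (product_topology (\<lambda>_. euclidean) UNIV) g f F"
    unfolding limitin_componentwise using assms by (auto intro: tendsto_eventually)
  then show ?thesis
    by (simp add: euclidean_product_topology)
qed

text \<open>
  Decoding letter by letter is continuous for every \<open>\<phi>\<close>, so the preimage of an analytic relation under
  the decoding is again the projection of a closed set.
\<close>

lemma analytic_relation_locally_comeager:
  fixes \<phi> :: "bool \<times> bool \<Rightarrow> bool \<times> bool"
  assumes "analytic_relation E" and "\<not> meager {f. pair_of (\<phi> \<circ> f) \<in> E}"
  shows "\<exists>u. meager (cylinder u - {f. pair_of (\<phi> \<circ> f) \<in> E})"
proof -
  obtain C :: "(((nat \<Rightarrow> bool) \<times> (nat \<Rightarrow> bool)) \<times> (nat \<Rightarrow> nat)) set"
    where "closed C" and C: "map_prod char_fun char_fun ` E = fst ` C"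
    using assms(1) unfolding analytic_relation_def analytic_set_def by blast
  define R where "R f w \<longleftrightarrow> ((fst \<circ> \<phi> \<circ> f, snd \<circ> \<phi> \<circ> f), w) \<in> C" for f w
  have "pair_of g \<in> E \<longleftrightarrow> (fst \<circ> g, snd \<circ> g) \<in> map_prod char_fun char_fun ` E" for g
  proof -
    have inj: "char_fun X = (\<lambda>t. P t) \<longleftrightarrow> X = {t. P t}" for X P
      by (auto simp: char_fun_def fun_eq_iff)
    have "(fst \<circ> g, snd \<circ> g) \<in> map_prod char_fun char_fun ` E \<longleftrightarrow>
      (\<exists>X Y. (X, Y) \<in> E \<and> char_fun X = (\<lambda>t. fst (g t)) \<and> char_fun Y = (\<lambda>t. snd (g t)))"
      by (force simp: comp_def)
    then show ?thesis
      by (simp add: inj pair_of_def)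
  qed
  then have E: "{f. pair_of (\<phi> \<circ> f) \<in> E} = {f. \<exists>w. R f w}"
    unfolding C R_def by (force simp: comp_assoc)
  have closed: "R f w"
    if "\<And>n. \<exists>g y. R g y \<and> initial g n = initial f n \<and> initial y n = initial w n" for f w
  proof -
    obtain g y where gy: "\<And>n. R (g n) (y n)"
      "\<And>n. initial (g n) n = initial f n" "\<And>n. initial (y n) n = initial w n"
      using \<open>\<And>n. \<exists>g y. R g y \<and> initial g n = initial f n \<and> initial y n = initial w n\<close> by metis
    have ev: "\<forall>\<^sub>F n in sequentially. g n t = f t" "\<forall>\<^sub>F n in sequentially. y n t = w t" for t
      using gy(2,3) unfolding initial_eq_iff
      by (auto intro: eventually_mono[OF eventually_gt_at_top[of t]])
    have "\<forall>\<^sub>F n in sequentially. c (\<phi> (g n t)) = c (\<phi> (f t))" for c :: "bool \<times> bool \<Rightarrow> bool" and t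
      using ev(1)[of t] by (rule eventually_mono) simp
    then have "(\<lambda>n. fst \<circ> \<phi> \<circ> g n) \<longlonglongrightarrow> (fst \<circ> \<phi> \<circ> f)" "(\<lambda>n. snd \<circ> \<phi> \<circ> g n) \<longlonglongrightarrow> (snd \<circ> \<phi> \<circ> f)"
      "y \<longlonglongrightarrow> w"
      using ev by (auto intro!: tendsto_if_eventually_coordinatewise_eq)
    then have "(\<lambda>n. ((fst \<circ> \<phi> \<circ> g n, snd \<circ> \<phi> \<circ> g n), y n)) \<longlonglongrightarrow> ((fst \<circ> \<phi> \<circ> f, snd \<circ> \<phi> \<circ> f), w)"
      by (intro tendsto_Pair)
    then show ?thesis
      unfolding R_def
      by (rule closed_sequentially[OF \<open>closed C\<close>, rotated]) (use gy(1) in \<open>simp add: R_def\<close>)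
  qed
  show ?thesis
    unfolding E
    by (rule nonmeager_projection_locally_comeager[OF closed assms(2)[unfolded E]])
qed

section \<open>The two cases of the dichotomy\<close>

text \<open>
  The map \<open>\<phi>\<close> is meant to be the identity, for the space of all pairs, or \<open>nest\<close>, for that of nested
  pairs. It must fix the letters \<open>(False, q)\<close> because, where the pair of sets does not follow \<open>z\<close>, the
  first set is empty while the second one is arbitrary.
\<close>

lemma homogeneous_if_nonmeager:
  assumes "equiv UNIV E" and "analytic_relation E"
    and \<phi>: "\<And>q. \<phi> (False, q) = (False, q)"
    and "\<not> meager {f. pair_of (\<phi> \<circ> f) \<in> E}"
  shows "\<exists>A :: nat \<Rightarrow> nat set. disjoint_family A \<and> (\<forall>n. A n \<noteq> {}) \<and>
    (\<forall>S T. 0 \<in> S \<and> 0 \<in> T \<longrightarrow> ((\<Union>i\<in>S. A i), (\<Union>i\<in>T. A i)) \<in> E)"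
proof -
  obtain u where "meager (cylinder u - {f. pair_of (\<phi> \<circ> f) \<in> E})"
    using analytic_relation_locally_comeager assms(2,4) by blast
  from meager_avoided_by_blocks[OF this, of u]
  obtain a z where a: "strict_mono a" and a0: "a 0 = length u" and zu: "\<forall>t<length u. z t = u ! t"
    and az: "\<And>f. \<exists>\<^sub>\<infinity>n. \<forall>t\<in>{a n..<a (Suc n)}. f t = z t \<Longrightarrow> f \<notin> cylinder u - {f. pair_of (\<phi> \<circ> f) \<in> E}"
    by blast
  \<comment> \<open>\<open>G\<close> is where the pair follows \<open>z\<close>; the odd blocks leave room for the sets \<open>A n\<close>.\<close>
  define G where "G = {..<length u} \<union> (\<Union>n. {a (2 * n)..<a (Suc (2 * n))})"
  define X where "X = {t \<in> G. fst (\<phi> (z t))}"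
  define A where "A n = {a (Suc (2 * n))} \<union> (if n = 0 then {t \<in> G. snd (\<phi> (z t))} else {})" for n
  have odd: "a (Suc (2 * n)) \<notin> G" for n
  proof
    assume "a (Suc (2 * n)) \<in> G"
    moreover have "length u < a (Suc (2 * n))"
      using strict_monoD[OF a, of 0 "Suc (2 * n)"] a0 by simp
    ultimately obtain m where m: "a (Suc (2 * n)) \<in> {a (2 * m)..<a (Suc (2 * m))}"
      by (auto simp: G_def)
    have "a (Suc (2 * n)) \<in> {a (Suc (2 * n))..<a (Suc (Suc (2 * n)))}"
      using strict_monoD[OF a, of "Suc (2 * n)" "Suc (Suc (2 * n))"] by simp
    with m have "2 * m = Suc (2 * n)"
      using block_unique[OF a] by blast
    then show False by presburger
  qed
  have "a (Suc (2 * n)) = a (Suc (2 * m)) \<longleftrightarrow> n = m" for n m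
    using strict_mono_eq[OF a] by simp
  then have disj: "disjoint_family A"
    unfolding disjoint_family_on_def A_def using odd by auto
  have XE: "(X, \<Union>i\<in>S. A i) \<in> E" if "0 \<in> S" for S
  proof -
    define Y where "Y = (\<Union>i\<in>S. A i)"
    have Y: "t \<in> Y \<longleftrightarrow> snd (\<phi> (z t))" if "t \<in> G" for t
    proof -
      have "t \<noteq> a (Suc (2 * n))" for n
        using that odd by metis
      then show ?thesis
        using that \<open>0 \<in> S\<close> by (auto simp: Y_def A_def split: if_splits)
    qed
    define f where "f t = (if t \<in> G then z t else (t \<in> X, t \<in> Y))" for t
    have "\<phi> \<circ> f = (\<lambda>t. (t \<in> X, t \<in> Y))"
      by (auto simp: fun_eq_iff f_def X_def Y \<phi> prod_eq_iff)
    then have f: "pair_of (\<phi> \<circ> f) = (X, Y)"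
      by (simp add: pair_of_char)
    have "\<forall>t\<in>{a (2 * n)..<a (Suc (2 * n))}. f t = z t" for n
      by (auto simp: f_def G_def)
    then have "\<exists>\<^sub>\<infinity>n. \<forall>t\<in>{a n..<a (Suc n)}. f t = z t"
      unfolding INFM_nat_le by (metis le_add2 mult_2)
    moreover have "f \<in> cylinder u"
      by (auto simp: cylinder_def initial_def f_def G_def zu intro!: nth_equalityI)
    ultimately show ?thesis
      using az[of f] f by (auto simp: Y_def)
  qed
  have "((\<Union>i\<in>S. A i), (\<Union>i\<in>T. A i)) \<in> E" if "0 \<in> S" "0 \<in> T" for S T
    using XE[OF that(1)] XE[OF that(2)] assms(1) by (meson equivE symE transE)
  moreover have "\<forall>n. A n \<noteq> {}" by (simp add: A_def)
  ultimately show ?thesis using disj by blast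
qed

text \<open>
  By symmetry of \<open>E\<close>, only index sets with some \<open>j \<in> T - S\<close> need to be considered. If also some
  \<open>i \<in> S - T\<close> exists, then \<open>A i\<close> and \<open>A j\<close> realise the letters \<open>(True, False)\<close> and \<open>(False, True)\<close>, while
  \<open>A 0\<close> realises \<open>(True, True)\<close> and points outside all the \<open>A n\<close> realise \<open>(False, False)\<close>. If
  \<open>S \<subseteq> T\<close>, then \<open>(True, False)\<close> cannot be realised, but \<open>nest\<close> replaces it by \<open>(False, False)\<close>.
\<close>

lemma independent_if_meager:
  assumes "sym E"
    and "meager {f. pair_of f \<in> E}" and "meager {f. pair_of (nest \<circ> f) \<in> E}"
  shows "\<exists>A :: nat \<Rightarrow> nat set. disjoint_family A \<and> (\<forall>n. A n \<noteq> {}) \<and>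
    (\<forall>S T. 0 \<in> S \<and> 0 \<in> T \<and> S \<noteq> T \<longrightarrow> ((\<Union>i\<in>S. A i), (\<Union>i\<in>T. A i)) \<notin> E)"
proof -
  obtain a z where a: "strict_mono a"
    and az: "\<And>f. \<exists>\<^sub>\<infinity>n. \<forall>t\<in>{a n..<a (Suc n)}. f t = z t \<Longrightarrow> pair_of f \<notin> E \<and> pair_of (nest \<circ> f) \<notin> E"
    using meager_avoided_by_blocks[OF meager_Un[OF assms(2,3)], of "[]"] by auto
  \<comment> \<open>The second component of the decoded number is discarded, so \<open>c\<close> takes each value infinitely often.\<close>
  define c where "c n = prod_decode (fst (prod_decode n))" for n
  have c_inf: "\<exists>\<^sub>\<infinity>n. c n = ij" for ij
    unfolding INFM_nat_le
  proof
    fix m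
    have "c (prod_encode (prod_encode ij, m)) = ij" by (simp add: c_def)
    then show "\<exists>n\<ge>m. c n = ij" using le_prod_encode_2 by blast
  qed
  \<comment> \<open>\<open>col (i, j) pq\<close> is the index of the set that receives the points with letter \<open>pq\<close> of a block
      assigned to \<open>(i, j)\<close>. Pairs with \<open>i = j\<close> separate nothing, so they are free to
      guarantee that \<open>A i\<close> is nonempty; pairs with \<open>i = 0\<close> serve nested index sets.\<close>
  define col where "col = (\<lambda>(i, j) pq. if i = j then Some i
      else if pq = (True, True) then Some 0
      else if pq = (True, False) \<and> i \<noteq> 0 then Some i
      else if pq = (False, True) then Some j
      else None :: nat option)"
  define A where "A m = {t. \<exists>n. t \<in> {a n..<a (Suc n)} \<and> col (c n) (z t) = Some m}" for m
  have A_block: "t \<in> A m \<longleftrightarrow> col (c n) (z t) = Some m" if "t \<in> {a n..<a (Suc n)}" for t n m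
    using that block_unique[OF a that] unfolding A_def by blast
  have disj: "disjoint_family A"
    unfolding disjoint_family_on_def
  proof (intro ballI impI, rule ccontr)
    fix m m' assume "m \<noteq> m'" "A m \<inter> A m' \<noteq> {}"
    then obtain t n where "t \<in> {a n..<a (Suc n)}" "t \<in> A m" "t \<in> A m'"
      by (auto simp: A_def)
    then show False using A_block \<open>m \<noteq> m'\<close> by simp
  qed
  have ne: "A m \<noteq> {}" for m
  proof -
    obtain n where n: "c n = (m, m)" using c_inf[of "(m, m)"] by (auto dest: INFM_EX)
    have "a n \<in> {a n..<a (Suc n)}" using strict_monoD[OF a, of n "Suc n"] by simp
    then have "a n \<in> A m" using A_block[of "a n" n m] n by (simp add: col_def)
    then show ?thesis by blast
  qed
  have key: "((\<Union>i\<in>S. A i), (\<Union>i\<in>T. A i)) \<notin> E" if S: "0 \<in> S" and T: "0 \<in> T" and j: "j \<in> T" "j \<notin> S" for S T j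
  proof -
    define X Y where "X = (\<Union>i\<in>S. A i)" and "Y = (\<Union>i\<in>T. A i)"
    have XY: "t \<in> X \<longleftrightarrow> (\<exists>i\<in>S. col (c n) (z t) = Some i)"
      "t \<in> Y \<longleftrightarrow> (\<exists>i\<in>T. col (c n) (z t) = Some i)" if "t \<in> {a n..<a (Suc n)}" for t n
      using A_block[OF that] by (auto simp: X_def Y_def)
    have "j \<noteq> 0" using S j by metis
    show ?thesis
    proof (cases "S \<subseteq> T")
      case True
      \<comment> \<open>A code of the nested pair \<open>(X, Y)\<close> through \<open>nest\<close> that agrees with \<open>z\<close> itself, including the
          letters \<open>(True, False)\<close>, on the blocks assigned to \<open>(0, j)\<close>.\<close>
      define f where "f t = (if \<exists>n. t \<in> {a n..<a (Suc n)} \<and> c n = (0, j) then z t else (t \<in> X, t \<in> Y))" for t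
      have "\<exists>\<^sub>\<infinity>n. \<forall>t\<in>{a n..<a (Suc n)}. f t = z t"
        by (rule INFM_mono[OF c_inf[of "(0, j)"]]) (auto simp: f_def)
      moreover have "(nest \<circ> f) t = (t \<in> X, t \<in> Y)" for t
      proof (cases "\<exists>n. t \<in> {a n..<a (Suc n)} \<and> c n = (0, j)")
        case t: True
        then obtain n where "t \<in> {a n..<a (Suc n)}" "c n = (0, j)" by blast
        then show ?thesis
          using t XY[of t n] S T j \<open>j \<noteq> 0\<close>
          by (cases "z t") (auto simp: f_def col_def nest_def split: if_splits)
      next
        case False
        have "X \<subseteq> Y" using True by (auto simp: X_def Y_def)
        then show ?thesis using False by (auto simp: f_def nest_def)
      qed
      then have "nest \<circ> f = (\<lambda>t. (t \<in> X, t \<in> Y))" by blast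
      ultimately show ?thesis
        using az[of f] by (simp add: pair_of_char flip: X_def Y_def)
    next
      case False
      then obtain i where i: "i \<in> S" "i \<notin> T" by blast
      then have "i \<noteq> 0" "i \<noteq> j" using T j by metis+
      have "\<exists>\<^sub>\<infinity>n. \<forall>t\<in>{a n..<a (Suc n)}. (t \<in> X, t \<in> Y) = z t"
      proof (rule INFM_mono[OF c_inf[of "(i, j)"]], intro ballI)
        fix n t assume "c n = (i, j)" "t \<in> {a n..<a (Suc n)}"
        then show "(t \<in> X, t \<in> Y) = z t"
          using XY[of t n] S T i j \<open>i \<noteq> 0\<close> \<open>i \<noteq> j\<close>
          by (cases "z t") (auto simp: col_def split: if_splits)
      qed
      from az[OF this] show ?thesis
        by (simp add: pair_of_char flip: X_def Y_def)
    qed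
  qed
  have "((\<Union>i\<in>S. A i), (\<Union>i\<in>T. A i)) \<notin> E" if "0 \<in> S" "0 \<in> T" "S \<noteq> T" for S T
    using key[of S T] key[of T S] that symD[OF assms(1)] by blast
  then show ?thesis using disj ne by blast
qed

theorem theorem0p1:
  fixes E :: "(nat set \<times> nat set) set"
  assumes "equiv UNIV E" and "analytic_relation E"
  shows "\<exists>A :: nat \<Rightarrow> nat set.
           disjoint_family A \<and> (\<forall>n. A n \<noteq> {}) \<and>
           ((\<forall>S T. 0 \<in> S \<and> 0 \<in> T \<and> S \<noteq> T \<longrightarrow> ((\<Union>i\<in>S. A i), (\<Union>i\<in>T. A i)) \<in> E) \<or>
            (\<forall>S T. 0 \<in> S \<and> 0 \<in> T \<and> S \<noteq> T \<longrightarrow> ((\<Union>i\<in>S. A i), (\<Union>i\<in>T. A i)) \<notin> E))"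
proof (cases "meager {f. pair_of f \<in> E} \<and> meager {f. pair_of (nest \<circ> f) \<in> E}")
  case True
  then show ?thesis
    using independent_if_meager[of E] assms(1) by (meson equivE)
next
  case False
  have "\<exists>\<phi>. (\<forall>q. \<phi> (False, q) = (False, q)) \<and> \<not> meager {f. pair_of (\<phi> \<circ> f) \<in> E}"
  proof (cases "meager {f. pair_of f \<in> E}")
    case True
    then show ?thesis using False by (intro exI[of _ nest]) (simp add: nest_def)
  next
    case False
    then show ?thesis by (intro exI[of _ id]) simp
  qed
  then show ?thesis
    using homogeneous_if_nonmeager[OF assms] by meson
qed

end
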